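(* Let $q\in\mathbb{C}$ with $|q|<1$. Then $$\sum_{n=0}^{\infty}\frac{(-1)^{n}q^{n^2+2n}(q;q^2)_{n}}{(-q;q^2)_{n}(q^4;q^4)_{n}} =\frac{(-q;q^5)_{\infty}(-q^4;q^5)_{\infty}(q^5;q^5)_{\infty}(q;q^2)_{\infty}}{(q^2;q^2)_{\infty}}.$$
   Context: For $|q|<1$, $x\in\mathbb{C}$ and an integer $n\ge 0$: $(x;q)_n=\prod_{j=0}^{n-1}(1-xq^j)$ (so $(x;q)_0=1$) and $(x;q)_\infty=\prod_{j=0}^{\infty}(1-xq^j)$. The same notation is used with base $q^m$ in place of $q$. *)

theory Defs
  imports "HOL-Analysis.Analysis"
begin

definition qpoch :: "complex \<Rightarrow> complex \<Rightarrow> nat \<Rightarrow> complex" where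
  "qpoch x q n = (\<Prod>j<n. 1 - x * q ^ j)"

text \<open>
  For \<open>norm q < 1\<close> the product converges absolutely. Vanishing factors do no harm:
  \<^const>\<open>prodinf\<close> is then \<open>0\<close>.
\<close>
definition qpoch_inf :: "complex \<Rightarrow> complex \<Rightarrow> complex" where
  "qpoch_inf x q = (\<Prod>j. 1 - x * q ^ j)"

end

theory Submission
  imports Defs
begin

text \<open>
  The proof is an instance of Bailey's lemma in base \<open>q\<^sup>2\<close>. The factor
  \<open>1 / ((-q;q\<^sup>2)\<^sub>n (q\<^sup>4;q\<^sup>4)\<^sub>n)\<close> is the \<open>\<beta>\<close>-side of a Bailey pair relative to \<open>a = q\<^sup>2\<close>, so
  the series becomes a double sum. Interchanging the summations, the inner sum is a
  \<open>\<^sub>1\<phi>\<^sub>1\<close>-series, which has a product form, and the remaining theta series is evaluated by the Jacobi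
  triple product in base \<open>q\<^sup>5\<close>.
\<close>

section \<open>Finite and infinite q-Pochhammer symbols\<close>

lemma qpoch_0 [simp]: "qpoch x q 0 = 1"
  by (simp add: qpoch_def)

lemma qpoch_Suc: "qpoch x q (Suc n) = qpoch x q n * (1 - x * q ^ n)"
  by (simp add: qpoch_def)

lemma qpoch_add: "qpoch x q (m + n) = qpoch x q m * qpoch (x * q ^ m) q n"
  by (induction n) (simp_all add: qpoch_Suc power_add mult.assoc)

lemma norm_mult_power_less_1:
  fixes x q :: complex
  assumes "norm x < 1" "norm q < 1"
  shows "norm (x * q ^ n) < 1"
proof -
  have "norm (x * q ^ n) \<le> norm x * 1"
    unfolding norm_mult norm_power using assms by (intro mult_left_mono power_le_one) auto
  then show ?thesis using assms by simp
qed

lemma one_minus_nonzero: "norm (x :: complex) < 1 \<Longrightarrow> 1 - x \<noteq> 0"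
  by auto

lemma qpoch_nonzero:
  assumes "norm x < 1" "norm q < 1"
  shows "qpoch x q n \<noteq> 0"
  using one_minus_nonzero[OF norm_mult_power_less_1[OF assms]] by (simp add: qpoch_def)

lemma convergent_prod_qpoch:
  fixes x q :: complex
  assumes "norm q < 1"
  shows "convergent_prod (\<lambda>j. 1 - x * q ^ j)"
proof -
  have "summable (\<lambda>j. norm x * norm q ^ j)"
    using assms by (intro summable_mult summable_geometric) auto
  moreover have "norm (1 - x * q ^ j - 1) = norm x * norm q ^ j" for j
    by (simp add: norm_mult norm_power)
  ultimately have "abs_convergent_prod (\<lambda>j. 1 - x * q ^ j)"
    by (simp only: abs_convergent_prod_conv_summable)
  then show ?thesis
    by (rule abs_convergent_prod_imp_convergent_prod)
qed

lemma qpoch_LIMSEQ: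
  assumes "norm q < 1"
  shows "qpoch x q \<longlonglongrightarrow> qpoch_inf x q"
  using convergent_prod_LIMSEQ[OF convergent_prod_qpoch[OF assms, of x]]
  unfolding qpoch_def [abs_def] qpoch_inf_def by (simp add: LIMSEQ_lessThan_iff_atMost)

lemma qpoch_inf_nonzero:
  assumes "norm x < 1" "norm q < 1"
  shows "qpoch_inf x q \<noteq> 0"
  unfolding qpoch_inf_def
  using one_minus_nonzero[OF norm_mult_power_less_1[OF assms]] convergent_prod_qpoch[OF assms(2)]
  by (intro prodinf_nonzero) auto

lemma qpoch_inf_split:
  assumes "norm q < 1"
  shows "qpoch_inf x q = qpoch x q n * qpoch_inf (x * q ^ n) q"
proof -
  have "(\<lambda>m. qpoch x q (n + m)) \<longlonglongrightarrow> qpoch x q n * qpoch_inf (x * q ^ n) q"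
    unfolding qpoch_add by (intro tendsto_intros qpoch_LIMSEQ assms)
  moreover have "(\<lambda>m. qpoch x q (m + n)) \<longlonglongrightarrow> qpoch_inf x q"
    by (rule LIMSEQ_ignore_initial_segment[OF qpoch_LIMSEQ[OF assms]])
  ultimately show ?thesis
    by (simp add: add.commute LIMSEQ_unique)
qed

text \<open>This bound and the next one for inverses are uniform in \<open>n\<close>; they supply
  the majorants for all interchanges of limits and sums below. For the inverses the nonvanishing
  limit is essential.\<close>

lemma qpoch_bounded:
  assumes "norm q < 1"
  obtains K where "K > 0" "\<And>n. norm (qpoch x q n) \<le> K"
  using BseqE[OF convergent_imp_Bseq[OF convergentI[OF qpoch_LIMSEQ[OF assms]]]] by blast

lemma inverse_qpoch_bounded:
  assumes "norm x < 1" "norm q < 1"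
  obtains K where "K > 0" "\<And>n. norm (inverse (qpoch x q n)) \<le> K"
  using BseqE[OF convergent_imp_Bseq[OF convergentI[OF
    tendsto_inverse[OF qpoch_LIMSEQ[OF assms(2)] qpoch_inf_nonzero[OF assms]]]]] by blast

section \<open>Telescoping sums and the Bailey pair\<close>

lemma Suc_choose_two: "Suc n choose 2 = (n choose 2) + n"
  by (simp add: numeral_2_eq_2)

text \<open>Quadratic exponents such as r(3r - 1)/2 are written with binomial coefficients to avoid
  division in \<open>nat\<close>; this identity converts the squares.\<close>

lemma double_choose_two: "2 * (n choose 2) + n = n * n"
  by (induction n) (auto simp: Suc_choose_two)

text \<open>
  Creative telescoping for sums of the shape of the \<open>\<beta>\<close>-side of a Bailey pair: the rational
  certificate, cleared of the \<open>q\<close>-factorials, is \<open>h\<close>.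
\<close>
lemma bailey_sum_recurrence:
  fixes p a b :: complex and c h :: "nat \<Rightarrow> complex"
  assumes p: "norm p < 1" and h0: "h 0 = 0"
    and step: "\<And>k. k \<le> Suc n \<Longrightarrow>
      a * c k - b * c k * (1 - p ^ (Suc n - k)) * (1 - p ^ (n + k + 2)) =
      h (Suc k) * (1 - p ^ (Suc n - k)) - h k * (1 - p ^ (n + k + 2))"
  shows "a * (\<Sum>k\<le>Suc n. c k / (qpoch p p (Suc n - k) * qpoch p p (Suc n + k + 1))) =
         b * (\<Sum>k\<le>n. c k / (qpoch p p (n - k) * qpoch p p (n + k + 1)))"
proof -
  define u where "u = (\<lambda>k. c k / (qpoch p p (Suc n - k) * qpoch p p (Suc n + k + 1)))"
  define v where "v = (\<lambda>k. c k / (qpoch p p (n - k) * qpoch p p (n + k + 1)))"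
  have nz: "qpoch p p i \<noteq> 0" for i
    by (rule qpoch_nonzero[OF p p])
  have fz: "1 - p ^ Suc i \<noteq> 0" for i
    using one_minus_nonzero[OF norm_mult_power_less_1[OF p p]] by simp
  \<comment> \<open>For \<open>m \<le> Suc n\<close> only indices \<open>k \<le> n\<close> occur,
    which belong to both sums. The extra index \<open>Suc n\<close> of the first sum is treated
    afterwards.\<close>
  have partial: "a * (\<Sum>k<m. u k) - b * (\<Sum>k<m. v k) =
      h m / (qpoch p p (Suc n - m) * qpoch p p (n + m + 1))" if "m \<le> Suc n" for m
    using that
  proof (induction m)
    case 0
    then show ?case by (simp add: h0)
  next
    case (Suc m)
    define A B where "A = qpoch p p (n - m)" and "B = qpoch p p (n + m + 1)"
    define s t where "s = 1 - p ^ (Suc n - m)" and "t = 1 - p ^ (n + m + 2)"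
    have A: "qpoch p p (Suc n - m) = A * s"
      using Suc.prems by (simp add: A_def s_def Suc_diff_le qpoch_Suc)
    have B: "qpoch p p (Suc n + m + 1) = B * t"
      by (simp add: B_def t_def qpoch_Suc)
    have nz': "A \<noteq> 0" "B \<noteq> 0" "s \<noteq> 0" "t \<noteq> 0"
      using nz Suc.prems fz[of "n - m"] fz[of "n + m + 1"]
      by (auto simp: A_def B_def s_def t_def Suc_diff_le)
    have st: "a * c m - b * c m * s * t = h (Suc m) * s - h m * t"
      using step[of m] Suc.prems by (simp add: s_def t_def)
    have "a * (\<Sum>k<Suc m. u k) - b * (\<Sum>k<Suc m. v k)
        = (a * (\<Sum>k<m. u k) - b * (\<Sum>k<m. v k)) + (a * u m - b * v m)"
      by (simp add: algebra_simps)
    also have "\<dots> = h m / (A * s * B) + (a * (c m / (A * s * (B * t))) - b * (c m / (A * B)))"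
      using Suc.IH Suc.prems A B unfolding u_def v_def by (simp add: A_def B_def)
    also have "\<dots> = (h m * t + (a * c m - b * c m * s * t)) / (A * s * B * t)"
      using nz' by (simp add: field_simps)
    also have "\<dots> = h (Suc m) / (A * (B * t))"
      unfolding st using nz' by (simp add: field_simps)
    finally show ?case
      using B by (simp add: A_def)
  qed
  define B t where "B = qpoch p p (n + Suc n + 1)" and "t = 1 - p ^ (n + Suc n + 2)"
  have B: "qpoch p p (Suc n + Suc n + 1) = B * t"
    by (simp add: B_def t_def qpoch_Suc)
  have nz': "B \<noteq> 0" "t \<noteq> 0"
    using nz fz[of "n + n + 2"] by (auto simp: B_def t_def)
  \<comment> \<open>The term \<open>k = Suc n\<close> occurs in the first sum only. There the factor
    \<open>1 - p ^ (Suc n - k)\<close> is 0, so \<open>step\<close> says that this term cancels the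
    boundary value \<open>h (Suc n) / B\<close>.\<close>
  have "a * (\<Sum>k\<le>Suc n. u k) - b * (\<Sum>k\<le>n. v k)
      = (a * (\<Sum>k<Suc n. u k) - b * (\<Sum>k<Suc n. v k)) + a * u (Suc n)"
    by (simp add: lessThan_Suc_atMost distrib_left)
  also have "\<dots> = h (Suc n) / B + a * c (Suc n) / (B * t)"
    by (subst partial) (use B in \<open>simp_all add: u_def B_def\<close>)
  also have "\<dots> = (h (Suc n) * t + a * c (Suc n)) / (B * t)"
    using nz' by (simp add: field_simps)
  also have "\<dots> = 0"
    using step[of "Suc n"] by (simp add: t_def algebra_simps)
  finally show ?thesis
    unfolding u_def v_def by simp
qed

text \<open>Up to the factor 1 - q^2, absorbed into the second denominator, this is beta_n = sum
  alpha_r / ((q^2;q^2)_{n-r} (q^4;q^2)_{n+r}). Both sides equal 1 at \<open>n = 0\<close> and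
  satisfy the same first-order recurrence in \<open>n\<close>.\<close>

lemma bailey_pair:
  assumes q: "norm q < 1" "q \<noteq> 0"
  shows "(\<Sum>r\<le>n. (-1) ^ r * q ^ (3 * (r choose 2) + r) * (1 - q ^ (4 * r + 2))
            / (qpoch (q\<^sup>2) (q\<^sup>2) (n - r) * qpoch (q\<^sup>2) (q\<^sup>2) (n + r + 1)))
       = 1 / (qpoch (- q) (q\<^sup>2) n * qpoch (q ^ 4) (q ^ 4) n)"
proof (induction n)
  case 0
  have "1 - q\<^sup>2 \<noteq> 0"
    using q by (intro one_minus_nonzero) (simp add: norm_power power_less_one_iff)
  then show ?case
    by (simp add: qpoch_def binomial_eq_0 power2_eq_square)
next
  case (Suc n)
  define X where "X = q ^ (2 * n + 1)"
  define w where "w = (\<lambda>r::nat. (-1) ^ r * q ^ (3 * (r choose 2) + r))"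
  \<comment> \<open>Telescoping certificate, with \<open>X\<close> = q^(2n+1) and \<open>R\<close> =
    q^r. At \<open>R = 1\<close> both brackets vanish, which gives \<open>h 0 = 0\<close>.\<close>
  define h where "h = (\<lambda>r. let R = q ^ r in w r *
    (X * (- q / R\<^sup>2 + R - 1 + q * R ^ 3) + X\<^sup>2 * (- q / R + q\<^sup>2 - q\<^sup>2 * R + q * R\<^sup>2)))"
  have q2: "norm (q\<^sup>2) < 1"
    using q by (simp add: norm_power power_less_one_iff)
  have w_Suc: "w (Suc r) = - q * (q ^ r) ^ 3 * w r" for r
    by (simp add: w_def Suc_choose_two power_add power_mult[symmetric] mult_ac)
  define S where "S = (\<lambda>n. \<Sum>r\<le>n. w r * (1 - q ^ (4 * r + 2))
        / (qpoch (q\<^sup>2) (q\<^sup>2) (n - r) * qpoch (q\<^sup>2) (q\<^sup>2) (n + r + 1)))"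
  have rec: "(1 + X) * (1 - X\<^sup>2 * q\<^sup>2) * S (Suc n) = 1 * S n"
    unfolding S_def
  proof (rule bailey_sum_recurrence[where h = h, OF q2])
    show "h 0 = 0"
      by (simp add: h_def)
    fix k assume k: "k \<le> Suc n"
    \<comment> \<open>Every power is expressed through \<open>q\<close>, \<open>X\<close> and
      \<open>R\<close>, the truncated difference \<open>Suc n - k\<close> becoming a quotient. The
      certificate condition is then a rational identity in these three quantities, times
      \<open>w k\<close>.\<close>
    define R where "R = q ^ k"
    have R: "R \<noteq> 0"
      using q by (simp add: R_def)
    have "q ^ (2 * (Suc n - k)) * R\<^sup>2 = q ^ (2 * (Suc n - k) + 2 * k)"
      by (simp add: R_def power_add power_mult[symmetric] mult_ac)
    also have "2 * (Suc n - k) + 2 * k = 2 * n + 2"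
      using k by simp
    finally have e1: "(q\<^sup>2) ^ (Suc n - k) = X * q / R\<^sup>2"
      using R by (simp add: X_def field_simps flip: power_mult)
    have "(q\<^sup>2) ^ (n + k + 2) = q ^ (2 * n + 1 + 3 + k * 2)"
      by (subst power_mult[symmetric], rule arg_cong[of _ _ "\<lambda>i. q ^ i"]) simp
    also have "\<dots> = X * q ^ 3 * R\<^sup>2"
      by (simp only: X_def R_def power_add power_mult)
    finally have e2: "(q\<^sup>2) ^ (n + k + 2) = X * q ^ 3 * R\<^sup>2" .
    have e3: "q ^ (4 * k + 2) = q\<^sup>2 * R ^ 4"
      by (simp add: R_def power_add power2_eq_square mult_ac flip: power_mult)
    have e4: "q ^ Suc k = q * R"
      by (simp add: R_def)
    show "(1 + X) * (1 - X\<^sup>2 * q\<^sup>2) * (w k * (1 - q ^ (4 * k + 2))) -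
        1 * (w k * (1 - q ^ (4 * k + 2))) * (1 - (q\<^sup>2) ^ (Suc n - k)) * (1 - (q\<^sup>2) ^ (n + k + 2)) =
        h (Suc k) * (1 - (q\<^sup>2) ^ (Suc n - k)) - h k * (1 - (q\<^sup>2) ^ (n + k + 2))"
      unfolding h_def Let_def w_Suc e1 e2 e3 e4 R_def[symmetric]
      using R q(2) by (simp add: divide_simps) algebra
  qed
  have nz1: "1 + X \<noteq> 0"
    using one_minus_nonzero[of "- X"] q by (simp add: X_def norm_power power_less_one_iff del: power_Suc)
  have nz2: "1 - X\<^sup>2 * q\<^sup>2 \<noteq> 0"
    using q by (intro one_minus_nonzero)
     (simp add: X_def norm_power power_less_one_iff norm_mult flip: power_mult power_add power_Suc)
  have A: "qpoch (- q) (q\<^sup>2) (Suc n) = qpoch (- q) (q\<^sup>2) n * (1 + X)"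
    by (simp add: qpoch_Suc X_def power_mult)
  have B: "qpoch (q ^ 4) (q ^ 4) (Suc n) = qpoch (q ^ 4) (q ^ 4) n * (1 - X\<^sup>2 * q\<^sup>2)"
  proof -
    have "q ^ 4 * (q ^ 4) ^ n = q ^ ((2 * n + 1) * 2 + 2)"
      by (subst power_Suc[symmetric], subst power_mult[symmetric], rule arg_cong[of _ _ "\<lambda>i. q ^ i"]) simp
    also have "\<dots> = X\<^sup>2 * q\<^sup>2"
      by (simp only: X_def power_add power_mult)
    finally have "q ^ 4 * (q ^ 4) ^ n = X\<^sup>2 * q\<^sup>2" .
    then show ?thesis
      by (simp add: qpoch_Suc)
  qed
  have IH: "S n = 1 / (qpoch (- q) (q\<^sup>2) n * qpoch (q ^ 4) (q ^ 4) n)"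
    using Suc.IH by (simp only: S_def w_def)
  have "S (Suc n) = S n / ((1 + X) * (1 - X\<^sup>2 * q\<^sup>2))"
    using rec nz1 nz2 by (simp add: eq_divide_eq mult_ac)
  also have "\<dots> = 1 / (qpoch (- q) (q\<^sup>2) (Suc n) * qpoch (q ^ 4) (q ^ 4) (Suc n))"
    by (simp add: IH A B mult_ac)
  finally have "S (Suc n) = 1 / (qpoch (- q) (q\<^sup>2) (Suc n) * qpoch (q ^ 4) (q ^ 4) (Suc n))" .
  then show ?case
    by (simp only: S_def w_def)
qed

section \<open>Summation of the 1phi1 series\<close>

text \<open>
  Both sides satisfy \<open>F z = (1 - z) / (1 - a z) F (z p)\<close> and tend to \<open>1\<close> as \<open>z\<close> tends to \<open>0\<close>. For the
  series this is telescoping, with certificate \<open>g\<close>.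
\<close>
lemma sums_1phi1:
  assumes p: "norm p < 1" and z: "norm z < 1" and az: "norm (a * z) < 1"
  shows "(\<lambda>m. qpoch a p m * (- z) ^ m * p ^ (m choose 2) / (qpoch p p m * qpoch (a * z) p m))
    sums (qpoch_inf z p / qpoch_inf (a * z) p)"
proof -
  define t where "t = (\<lambda>y m. qpoch a p m * (- y) ^ m * p ^ (m choose 2)
    / (qpoch p p m * qpoch (a * y) p m))"
  define F where "F = (\<lambda>n. \<Sum>m. t (z * p ^ n) m)"
  obtain A where A: "A > 0" "\<And>n. norm (qpoch a p n) \<le> A"
    using qpoch_bounded[OF p] by blast
  obtain B where B: "B > 0" "\<And>n. norm (qpoch (a * z) p n) \<le> B"
    using qpoch_bounded[OF p] by blast
  obtain C where C: "C > 0" "\<And>n. norm (inverse (qpoch (a * z) p n)) \<le> C"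
    using inverse_qpoch_bounded[OF az p] by blast
  obtain D where D: "D > 0" "\<And>n. norm (inverse (qpoch p p n)) \<le> D"
    using inverse_qpoch_bounded[OF p p] by blast
  have az_n: "norm (a * (z * p ^ n)) < 1" for n
    using norm_mult_power_less_1[OF az p] by (simp add: mult.assoc)
  have bound: "norm (t (z * p ^ n) m) \<le> A * B * C * D * norm z ^ m * (norm p ^ n) ^ m" for n m
  proof -
    \<comment> \<open>The denominator moves with \<open>n\<close>. Writing it as a quotient of two
      symbols with the fixed argument \<open>a * z\<close> makes the bound uniform in
      \<open>n\<close>.\<close>
    have "inverse (qpoch (a * (z * p ^ n)) p m)
        = qpoch (a * z) p n * inverse (qpoch (a * z) p (n + m))"
      using qpoch_nonzero[OF az p] by (simp add: qpoch_add mult.assoc)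
    then have "t (z * p ^ n) m = qpoch a p m * qpoch (a * z) p n * inverse (qpoch (a * z) p (n + m))
        * inverse (qpoch p p m) * z ^ m * (p ^ n) ^ m * ((- 1) ^ m * p ^ (m choose 2))"
      by (simp add: t_def divide_inverse power_mult_distrib[symmetric] mult_ac)
    then have "norm (t (z * p ^ n) m) = norm (qpoch a p m) * norm (qpoch (a * z) p n)
        * norm (inverse (qpoch (a * z) p (n + m)))
        * norm (inverse (qpoch p p m)) * norm z ^ m * (norm p ^ n) ^ m * norm p ^ (m choose 2)"
      by (simp add: norm_mult norm_power)
    also have "\<dots> \<le> A * B * C * D * norm z ^ m * (norm p ^ n) ^ m * 1"
      using A B C D p by (intro mult_mono power_le_one) auto
    finally show ?thesis by simp
  qed
  \<comment> \<open>This weaker bound is free of \<open>n\<close> and serves as the majorant in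
    Tannery's theorem; the sharper one shows that each term with \<open>m > 0\<close> tends to
    0.\<close>
  have bound': "norm (t (z * p ^ n) m) \<le> A * B * C * D * norm z ^ m" for n m
  proof -
    have "(norm p ^ n) ^ m \<le> 1"
      using p by (intro power_le_one) auto
    then have "A * B * C * D * norm z ^ m * (norm p ^ n) ^ m \<le> A * B * C * D * norm z ^ m * 1"
      using A B C D by (intro mult_left_mono) auto
    then show ?thesis
      using bound[of n m] by linarith
  qed
  have geo: "summable (\<lambda>m. A * B * C * D * norm z ^ m)"
    using z by (intro summable_mult summable_geometric) auto
  have t_summable: "summable (t (z * p ^ n))" for n
    by (rule summable_comparison_test'[OF geo bound'])
  have t_lim: "(\<lambda>n. t (z * p ^ n) m) \<longlonglongrightarrow> (if m = 0 then 1 else 0)" for m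
  proof (cases "m = 0")
    case False
    have lim0: "(\<lambda>n. A * B * C * D * norm z ^ m * norm p ^ n) \<longlonglongrightarrow> 0"
      using p by (intro tendsto_mult_right_zero LIMSEQ_power_zero) auto
    have "norm (t (z * p ^ n) m) \<le> A * B * C * D * norm z ^ m * norm p ^ n" for n
    proof -
      have "(norm p ^ n) ^ m \<le> (norm p ^ n) ^ 1"
        using p False by (intro power_decreasing power_le_one) auto
      then have "A * B * C * D * norm z ^ m * (norm p ^ n) ^ m
          \<le> A * B * C * D * norm z ^ m * norm p ^ n"
        using A B C D by (intro mult_left_mono) auto
      then show ?thesis
        using bound[of n m] by linarith
    qed
    then have "(\<lambda>n. t (z * p ^ n) m) \<longlonglongrightarrow> 0"
      by (rule Lim_null_comparison[OF always_eventually[OF allI] lim0])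
    then show ?thesis
      using False by simp
  qed (simp add: t_def binomial_eq_0)
  have "F \<longlonglongrightarrow> (\<Sum>m. if m = 0 then 1 else 0)"
    unfolding F_def
    using tannerys_theorem[where a = "\<lambda>m n. t (z * p ^ n) m", OF t_lim _ geo] bound'
    by (simp add: case_prod_unfold)
  also have "(\<Sum>m. if m = 0 then 1 else 0 :: complex) = 1"
    using sums_unique[OF sums_single[of 0 "\<lambda>_. 1 :: complex"]] by simp
  finally have F_lim: "F \<longlonglongrightarrow> 1" .
  have step: "F n = (1 - z * p ^ n) / (1 - a * z * p ^ n) * F (Suc n)" for n
  proof -
    define y where "y = z * p ^ n"
    define g where "g = (\<lambda>m. - (1 - p ^ m) * t y m)"
    have "t y m - (1 - y) / (1 - a * y) * t (y * p) m = g (Suc m) - g m" for m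
    proof -
      define M where "M = p ^ m"
      have ay: "norm (a * y) < 1"
        using az_n by (simp add: y_def)
      have nz: "1 - a * y \<noteq> 0" "1 - a * y * M \<noteq> 0" "1 - p * M \<noteq> 0"
        using one_minus_nonzero ay norm_mult_power_less_1[OF ay p] norm_mult_power_less_1[OF p p]
        by (auto simp: M_def)
      \<comment> \<open>Split off the first and the last factor of
        \<open>qpoch (a * y) p (Suc m)\<close> and compare.\<close>
      have "(1 - a * y) * qpoch (a * (y * p)) p m = qpoch (a * y) p m * (1 - a * y * M)"
        using qpoch_add[of "a * y" p 1 m] qpoch_Suc[of "a * y" p m]
        by (simp add: qpoch_Suc mult_ac M_def)
      then have "qpoch (a * (y * p)) p m = qpoch (a * y) p m * (1 - a * y * M) / (1 - a * y)"
        using nz by (simp add: field_simps)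
      then have t1: "t (y * p) m = t y m * M * (1 - a * y) / (1 - a * y * M)"
        using nz by (simp add: t_def M_def power_mult_distrib power_commutes
            power_minus[of y] power_minus[of "y * p"] flip: power_mult)
           (simp add: mult_ac power_mult_distrib)
      have t2: "t y (Suc m) = - t y m * y * M * (1 - a * M) / ((1 - p * M) * (1 - a * y * M))"
        using nz by (simp add: t_def M_def qpoch_Suc Suc_choose_two power_add mult_ac)
      have p_Suc: "p ^ Suc m = p * M"
        by (simp add: M_def)
      show ?thesis
        unfolding g_def t1 t2 p_Suc M_def[symmetric] using nz
        by (simp add: divide_simps) algebra
    qed
    moreover have "(\<lambda>m. t y m - (1 - y) / (1 - a * y) * t (y * p) m) sums
        (F n - (1 - y) / (1 - a * y) * F (Suc n))"
    proof (intro sums_diff sums_mult)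
      show "t y sums F n"
        using t_summable[of n] by (simp add: F_def y_def summable_sums)
      show "t (y * p) sums F (Suc n)"
        using t_summable[of "Suc n"] by (simp add: F_def y_def summable_sums mult_ac)
    qed
    \<comment> \<open>Both boundary terms vanish: \<open>g 0\<close> because of the factor
      \<open>1 - p ^ 0\<close>, and the limit of \<open>g\<close> because the terms of a convergent
      series tend to 0.\<close>
    moreover have "g \<longlonglongrightarrow> - (1 - 0) * 0"
      unfolding g_def using p t_summable[of n]
      by (intro tendsto_intros LIMSEQ_power_zero summable_LIMSEQ_zero) (auto simp: y_def)
    then have "(\<lambda>m. g (Suc m) - g m) sums (0 - g 0)"
      using telescope_sums[of g 0] by simp
    ultimately have "F n - (1 - y) / (1 - a * y) * F (Suc n) = 0"
      by (simp add: g_def sums_iff)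
    then show ?thesis
      by (simp add: y_def mult.assoc)
  qed
  have F_0: "F 0 = qpoch z p n / qpoch (a * z) p n * F n" for n
  proof (induction n)
    case (Suc n)
    then show ?case
      by (simp add: step[of n] qpoch_Suc)
  qed simp
  \<comment> \<open>By \<open>F_0\<close> this sequence is constantly \<open>F 0\<close>, so its
    limit is the value sought.\<close>
  have "(\<lambda>n. qpoch z p n / qpoch (a * z) p n * F n) \<longlonglongrightarrow>
      qpoch_inf z p / qpoch_inf (a * z) p * 1"
    by (intro tendsto_intros qpoch_LIMSEQ F_lim qpoch_inf_nonzero p az)
  then have F0: "F 0 = qpoch_inf z p / qpoch_inf (a * z) p"
    unfolding F_0[symmetric] using LIMSEQ_unique[OF tendsto_const] by simp
  have "t z sums F 0"
    using summable_sums[OF t_summable[of 0]] by (simp only: F_def power_0 mult_1_right)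
  then show ?thesis
    unfolding F0 t_def .
qed

section \<open>Interchange of summations\<close>

text \<open>The geometric majorant makes \<open>f\<close> absolutely summable over the whole
  quadrant, so summing by rows and summing along the diagonals r + m = n give the same
  value.\<close>

lemma triangle_sums:
  fixes f :: "nat \<Rightarrow> nat \<Rightarrow> complex"
  assumes bound: "\<And>r m. norm (f r m) \<le> C * s ^ r * s ^ m" and s: "0 \<le> s" "s < 1"
    and rows: "\<And>r. f r sums g r" and total: "g sums S"
  shows "(\<lambda>n. \<Sum>r\<le>n. f r (n - r)) sums S"
proof -
  define F where "F = (\<lambda>(r, m). f r m)"
  have geo: "(\<lambda>m. s ^ m) summable_on UNIV"
    using s by (simp add: summable_on_UNIV_nonneg_real_iff summable_geometric)
  have C: "0 \<le> C"
    using order_trans[OF norm_ge_zero bound[of 0 0]] by simp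
  have "(\<lambda>x. norm (case x of (r, m) \<Rightarrow> C * s ^ r * s ^ m)) summable_on UNIV \<times> UNIV"
  proof (subst Infinite_Sum.abs_summable_on_Sigma_iff, intro conjI ballI)
    have *: "norm (case (r, m) of (r, m) \<Rightarrow> C * s ^ r * s ^ m) = C * s ^ r * s ^ m" for r m
      using C s by simp
    show "(\<lambda>m. norm (case (r, m) of (r, m) \<Rightarrow> C * s ^ r * s ^ m)) summable_on UNIV" for r
      unfolding * by (rule summable_on_cmult_right[OF geo])
    define G where "G = (\<Sum>\<^sub>\<infinity>m. s ^ m)"
    have "(\<Sum>\<^sub>\<infinity>m. C * s ^ r * s ^ m) = C * s ^ r * G" for r
      unfolding G_def by (rule infsum_cmult_right')
    then have "norm (\<Sum>\<^sub>\<infinity>m. C * s ^ r * s ^ m) = (C * \<bar>G\<bar>) * s ^ r" for r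
      using C s by (simp add: abs_mult)
    then show "(\<lambda>r. norm (\<Sum>\<^sub>\<infinity>m. norm (case (r, m) of (r, m) \<Rightarrow> C * s ^ r * s ^ m))) summable_on UNIV"
      unfolding * by (simp only: summable_on_cmult_right[OF geo])
  qed
  then have "(\<lambda>x. norm (F x)) summable_on UNIV \<times> UNIV"
  proof (rule Infinite_Sum.abs_summable_on_comparison_test)
    show "norm (F x) \<le> norm (case x of (r, m) \<Rightarrow> C * s ^ r * s ^ m)" for x
      using order_trans[OF bound abs_ge_self] by (cases x) (simp add: F_def)
  qed
  then have "F summable_on UNIV \<times> UNIV"
    by (rule abs_summable_summable)
  then obtain T where T: "(F has_sum T) (UNIV \<times> UNIV)"
    by (auto simp: summable_on_def)
  have "(f r has_sum g r) UNIV" for r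
  proof -
    have "summable (\<lambda>m. norm (f r m))"
    proof (rule summable_comparison_test')
      show "summable (\<lambda>m. C * s ^ r * s ^ m)"
        using s by (intro summable_mult summable_geometric) simp
    qed (simp add: bound)
    then show ?thesis
      using norm_summable_imp_has_sum rows by blast
  qed
  then have "(g has_sum T) UNIV"
    by (intro has_sum_SigmaD[OF T]) (auto simp: F_def)
  then have "T = S"
    using has_sum_imp_sums sums_unique2 total by blast
  \<comment> \<open>The bijection (r, m) to (r + m, r) carries the quadrant to the triangle r \<le>
    n, whose sections are finite.\<close>
  have "((\<lambda>(n, r). f r (n - r)) has_sum T) (SIGMA n:UNIV. {..n})"
    using T by (rule iffD1[OF has_sum_reindex_bij_witness
        [where i = "\<lambda>(n, r). (r, n - r)" and j = "\<lambda>(r, m). (r + m, r)"], rotated -1])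
      (auto simp: F_def)
  then have "((\<lambda>n. \<Sum>r\<le>n. f r (n - r)) has_sum T) UNIV"
    by (rule has_sum_SigmaD) (auto intro!: has_sum_finiteI)
  then show ?thesis
    using \<open>T = S\<close> has_sum_imp_sums by blast
qed

section \<open>The Jacobi triple product\<close>

text \<open>
  The \<open>k\<close>-th summand combines the terms of index \<open>k\<close> and \<open>- k - 1\<close> of the usual bilateral sum; \<open>y\<close> stands
  for \<open>p / x\<close>.
\<close>
lemma finite_jacobi_triple_product:
  fixes p x y :: complex
  assumes p: "norm p < 1" "p \<noteq> 0" and xy: "x * y = p"
  shows "(\<Sum>k\<le>n. p ^ (k choose 2) * (x ^ k + y ^ Suc k * p ^ k)
            / (qpoch p p (n - k) * qpoch p p (n + k + 1)))
       = qpoch (- x) p n * qpoch (- y) p (Suc n) / qpoch p p (2 * n + 1)"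
proof (induction n)
  case 0
  show ?case
    by (simp add: qpoch_def binomial_eq_0)
next
  case (Suc n)
  define P where "P = p ^ n"
  define c where "c = (\<lambda>k::nat. p ^ (k choose 2) * (x ^ k + y ^ Suc k * p ^ k))"
  define S where "S = (\<lambda>n. \<Sum>k\<le>n. c k / (qpoch p p (n - k) * qpoch p p (n + k + 1)))"
  \<comment> \<open>Certificate for the recurrence in \<open>n\<close>, with \<open>K\<close> = p^k
    and \<open>P\<close> = p^n. At \<open>k = 0\<close> the \<open>x\<close> part and the
    \<open>y\<close> part coincide, hence \<open>h 0 = 0\<close>.\<close>
  define h where "h = (\<lambda>k. let K = p ^ k in p ^ (k choose 2) *
    (x ^ k * (p * P * (y - 1 / K) + p\<^sup>2 * P\<^sup>2 * (1 - y / K))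
     - y ^ k * (p * P * (y - K) + p\<^sup>2 * P\<^sup>2 * (1 - y * K))))"
  have rec: "(1 - p\<^sup>2 * P\<^sup>2) * (1 - p ^ 3 * P\<^sup>2) * S (Suc n) = (1 + x * P) * (1 + p * y * P) * S n"
    unfolding S_def
  proof (rule bailey_sum_recurrence[where h = h, OF p(1)])
    show "h 0 = 0"
      by (simp add: h_def)
    fix k assume k: "k \<le> Suc n"
    define K w U V where "K = p ^ k" and "w = p ^ (k choose 2)" and "U = x ^ k" and "V = y ^ k"
    have K: "K \<noteq> 0" "x \<noteq> 0" "y \<noteq> 0"
      using p xy by (auto simp: K_def)
    have "p ^ (Suc n - k) * K = p ^ Suc n"
      using k by (simp add: K_def del: power_Suc flip: power_add)
    then have e1: "1 - p ^ (Suc n - k) = (K - p * P) / K"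
      using K by (simp add: P_def field_simps)
    have e2: "1 - p ^ (n + k + 2) = 1 - p\<^sup>2 * P * K"
      by (simp add: P_def K_def power_add power2_eq_square)
    have c: "c k = w * (U + y * V * K)"
      by (simp add: c_def w_def U_def V_def K_def)
    \<comment> \<open>\<open>H\<close> is \<open>K * h k\<close> and \<open>H'\<close> is
      \<open>h (Suc k)\<close>, both free of division, so that the certificate condition becomes
      polynomial.\<close>
    define H where "H = w * (U * (p * P * (y * K - 1) + p\<^sup>2 * P\<^sup>2 * (K - y))
        - K * V * (p * P * (y - K) + p\<^sup>2 * P\<^sup>2 * (1 - y * K)))"
    define H' where "H' = w * (x * U * (P * (y * p * K - 1) + p * P\<^sup>2 * (p * K - y))
        - K * y * V * (p * P * (y - p * K) + p\<^sup>2 * P\<^sup>2 * (1 - y * p * K)))"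
    have "h k = w * (U * (p * P * (y - 1 / K) + p\<^sup>2 * P\<^sup>2 * (1 - y / K))
        - V * (p * P * (y - K) + p\<^sup>2 * P\<^sup>2 * (1 - y * K)))"
      by (simp add: h_def Let_def w_def U_def V_def K_def)
    also have "\<dots> = H / K"
      using K by (simp add: H_def field_simps)
    finally have h: "h k = H / K" .
    have "h (Suc k) = w * K * (x * U * (p * P * (y - 1 / (p * K)) + p\<^sup>2 * P\<^sup>2 * (1 - y / (p * K)))
        - y * V * (p * P * (y - p * K) + p\<^sup>2 * P\<^sup>2 * (1 - y * (p * K))))"
      by (simp add: h_def Let_def w_def U_def V_def K_def Suc_choose_two power_add)
    also have "\<dots> = H'"
      using K p by (simp add: H'_def field_simps power2_eq_square)
    finally have h': "h (Suc k) = H'" .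
    \<comment> \<open>After \<open>p\<close> is replaced by \<open>x * y\<close>, this is a
      polynomial identity in \<open>x\<close>, \<open>y\<close>, \<open>P\<close>, \<open>K\<close>,
      \<open>U\<close>, \<open>V\<close> and \<open>w\<close>.\<close>
    have cert: "(1 - p\<^sup>2 * P\<^sup>2) * (1 - p ^ 3 * P\<^sup>2) * c k * K -
        (1 + x * P) * (1 + p * y * P) * c k * (K - p * P) * (1 - p\<^sup>2 * P * K) =
        H' * (K - p * P) - H * (1 - p\<^sup>2 * P * K)"
      unfolding c H_def H'_def xy[symmetric]
      by (simp add: algebra_simps power2_eq_square power3_eq_cube)
    have clear: "a - b * (d / K) * t = u * (d / K) - v / K * t"
      if "a * K - b * d * t = u * d - v * t" for a b d t u v
      using that K by (simp add: field_simps)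
    show "(1 - p\<^sup>2 * P\<^sup>2) * (1 - p ^ 3 * P\<^sup>2) * c k -
        (1 + x * P) * (1 + p * y * P) * c k * (1 - p ^ (Suc n - k)) * (1 - p ^ (n + k + 2)) =
        h (Suc k) * (1 - p ^ (Suc n - k)) - h k * (1 - p ^ (n + k + 2))"
      unfolding h h' e1 e2 using cert by (rule clear)
  qed
  have C: "qpoch p p (2 * Suc n + 1) = qpoch p p (2 * n + 1) * (1 - p\<^sup>2 * P\<^sup>2) * (1 - p ^ 3 * P\<^sup>2)"
  proof -
    have "p ^ (2 * n) = P * P"
      by (simp only: P_def mult_2 power_add)
    then have "p * p ^ (2 * n + 1) = p\<^sup>2 * P\<^sup>2" "p * p ^ (2 * n + 2) = p ^ 3 * P\<^sup>2"
      by (simp_all add: power2_eq_square power3_eq_cube mult_ac)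
    then show ?thesis
      by (simp add: qpoch_Suc)
  qed
  then have nz: "1 - p\<^sup>2 * P\<^sup>2 \<noteq> 0" "1 - p ^ 3 * P\<^sup>2 \<noteq> 0"
    using qpoch_nonzero[OF p(1) p(1), of "2 * Suc n + 1"] by auto
  have IH: "S n = qpoch (- x) p n * qpoch (- y) p (Suc n) / qpoch p p (2 * n + 1)"
    using Suc.IH by (simp only: S_def c_def)
  have A: "qpoch (- x) p (Suc n) = qpoch (- x) p n * (1 + x * P)"
    by (simp add: qpoch_Suc P_def)
  have B: "qpoch (- y) p (Suc (Suc n)) = qpoch (- y) p (Suc n) * (1 + p * y * P)"
    by (simp add: qpoch_Suc[of _ _ "Suc n"] P_def mult_ac)
  have "S (Suc n) = (1 + x * P) * (1 + p * y * P) * S n / ((1 - p\<^sup>2 * P\<^sup>2) * (1 - p ^ 3 * P\<^sup>2))"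
    using rec nz by (simp add: eq_divide_eq mult_ac)
  also have "\<dots> = qpoch (- x) p (Suc n) * qpoch (- y) p (Suc (Suc n)) / qpoch p p (2 * Suc n + 1)"
    unfolding IH A B C by (simp add: mult_ac)
  finally have "S (Suc n) = qpoch (- x) p (Suc n) * qpoch (- y) p (Suc (Suc n)) / qpoch p p (2 * Suc n + 1)" .
  then show ?case
    by (simp only: S_def c_def)
qed

text \<open>The ratio of consecutive terms is \<open>p ^ k * x\<close>, which tends to 0 for every
  \<open>x\<close>.\<close>

lemma summable_theta:
  fixes p x :: complex
  assumes p: "norm p < 1"
  shows "summable (\<lambda>k. norm (p ^ (k choose 2) * x ^ k))"
proof -
  have "(\<lambda>k. norm (p ^ k * x)) \<longlonglongrightarrow> norm (0 * x)"
    using p by (intro tendsto_intros LIMSEQ_power_zero)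
  then have "eventually (\<lambda>k. norm (p ^ k * x) < 1 / 2) sequentially"
    by (intro order_tendstoD(2)) auto
  then obtain N where N: "\<And>k. k \<ge> N \<Longrightarrow> norm (p ^ k * x) < 1 / 2"
    by (auto simp: eventually_sequentially)
  show ?thesis
  proof (rule summable_ratio_test[of "1 / 2" N])
    fix k assume "k \<ge> N"
    have "norm (p ^ (Suc k choose 2) * x ^ Suc k) = norm (p ^ k * x) * norm (p ^ (k choose 2) * x ^ k)"
      by (simp add: Suc_choose_two power_add norm_mult mult_ac)
    also have "\<dots> \<le> 1 / 2 * norm (p ^ (k choose 2) * x ^ k)"
      using N[OF \<open>k \<ge> N\<close>] by (intro mult_right_mono) auto
    finally show "norm (norm (p ^ (Suc k choose 2) * x ^ Suc k))
        \<le> 1 / 2 * norm (norm (p ^ (k choose 2) * x ^ k))"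
      by simp
  qed simp
qed

text \<open>Let \<open>n\<close> tend to infinity in the finite form. Each summand tends to
  \<open>c k / (I * I)\<close> and the right side to a product over \<open>I\<close>; multiplying by
  \<open>I * I\<close> leaves one factor \<open>I\<close>.\<close>

lemma jacobi_triple_product:
  fixes p x y :: complex
  assumes p: "norm p < 1" "p \<noteq> 0" and xy: "x * y = p"
  shows "(\<lambda>k. p ^ (k choose 2) * (x ^ k + y ^ Suc k * p ^ k))
    sums (qpoch_inf (- x) p * qpoch_inf (- y) p * qpoch_inf p p)"
proof -
  define c where "c = (\<lambda>k::nat. p ^ (k choose 2) * (x ^ k + y ^ Suc k * p ^ k))"
  define I where "I = qpoch_inf p p"
  \<comment> \<open>Extension by 0 beyond \<open>n\<close> turns the finite sums into series over a
    fixed index set, as Tannery's theorem requires.\<close>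
  define a where "a = (\<lambda>k n. if k \<le> n then c k / (qpoch p p (n - k) * qpoch p p (n + k + 1)) else 0)"
  obtain D where D: "D > 0" "\<And>n. norm (inverse (qpoch p p n)) \<le> D"
    using inverse_qpoch_bounded[OF p(1) p(1)] by blast
  have I: "I \<noteq> 0"
    unfolding I_def by (rule qpoch_inf_nonzero[OF p(1) p(1)])
  have c_summable: "summable (\<lambda>k. norm (c k))"
  proof (rule summable_comparison_test')
    show "summable (\<lambda>k. norm (p ^ (k choose 2) * x ^ k)
        + norm y * norm (p ^ (k choose 2) * (y * p) ^ k))"
      by (intro summable_add summable_mult summable_theta p)
    have "c k = p ^ (k choose 2) * x ^ k + y * (p ^ (k choose 2) * (y * p) ^ k)" for k
      by (simp add: c_def power_mult_distrib algebra_simps)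
    then show "norm (norm (c k)) \<le> norm (p ^ (k choose 2) * x ^ k)
        + norm y * norm (p ^ (k choose 2) * (y * p) ^ k)" for k
      by (auto intro!: norm_triangle_le simp: norm_mult)
  qed
  have a_lim: "(\<lambda>n. a k n) \<longlonglongrightarrow> c k / (I * I)" for k
  \<comment> \<open>Shifting by \<open>k\<close> ensures \<open>k \<le> n\<close> and removes the
    truncated subtraction.\<close>
  proof (rule LIMSEQ_offset[of _ k])
    have "(\<lambda>n. qpoch p p (n + (2 * k + 1))) \<longlonglongrightarrow> I"
      unfolding I_def by (intro LIMSEQ_ignore_initial_segment qpoch_LIMSEQ p)
    then have "(\<lambda>n. c k / (qpoch p p n * qpoch p p (n + (2 * k + 1)))) \<longlonglongrightarrow> c k / (I * I)"
      using I by (intro tendsto_intros) (auto simp: I_def intro: qpoch_LIMSEQ p)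
    then show "(\<lambda>n. a k (n + k)) \<longlonglongrightarrow> c k / (I * I)"
      by (simp add: a_def add_ac mult_2)
  qed
  have a_bound: "norm (a k n) \<le> norm (c k) * (D * D)" for k n
  proof (cases "k \<le> n")
    case True
    then have "norm (a k n) = norm (c k) * (norm (inverse (qpoch p p (n - k)))
        * norm (inverse (qpoch p p (n + k + 1))))"
      by (simp add: a_def divide_inverse norm_mult norm_inverse)
    also have "\<dots> \<le> norm (c k) * (D * D)"
      using D by (intro mult_left_mono mult_mono) auto
    finally show ?thesis .
  qed (simp add: a_def)
  have "(\<Sum>k. a k n) = qpoch (- x) p n * qpoch (- y) p (Suc n) / qpoch p p (2 * n + 1)" for n
  proof -
    have "(\<Sum>k. a k n) = (\<Sum>k\<le>n. a k n)"
      by (rule suminf_finite) (auto simp: a_def)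
    also have "\<dots> = qpoch (- x) p n * qpoch (- y) p (Suc n) / qpoch p p (2 * n + 1)"
      unfolding finite_jacobi_triple_product[OF p xy, symmetric] by (simp add: a_def c_def)
    finally show ?thesis .
  qed
  moreover have "(\<lambda>n. qpoch (- x) p n * qpoch (- y) p (Suc n) / qpoch p p (2 * n + 1))
      \<longlonglongrightarrow> qpoch_inf (- x) p * qpoch_inf (- y) p / I"
  proof (intro tendsto_intros I)
    show "(\<lambda>n. qpoch (- y) p (Suc n)) \<longlonglongrightarrow> qpoch_inf (- y) p"
      by (intro LIMSEQ_Suc qpoch_LIMSEQ p)
    have "strict_mono (\<lambda>n::nat. 2 * n + 1)"
      by (simp add: strict_mono_def)
    from LIMSEQ_subseq_LIMSEQ[OF qpoch_LIMSEQ[OF p(1), of p] this]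
    show "(\<lambda>n. qpoch p p (2 * n + 1)) \<longlonglongrightarrow> I"
      by (simp add: o_def I_def)
  qed (rule qpoch_LIMSEQ[OF p(1)])
  moreover have "(\<lambda>n. \<Sum>k. a k n) \<longlonglongrightarrow> (\<Sum>k. c k / (I * I))"
    using tannerys_theorem[OF a_lim _ summable_mult2[OF c_summable, of "D * D"]] a_bound
    by (simp add: case_prod_unfold)
  ultimately have "(\<Sum>k. c k / (I * I)) = qpoch_inf (- x) p * qpoch_inf (- y) p / I"
    by (simp add: LIMSEQ_unique)
  moreover have "(\<Sum>k. c k / (I * I)) = (\<Sum>k. c k) / (I * I)"
    by (rule suminf_divide[OF summable_norm_cancel[OF c_summable]])
  ultimately have "(\<Sum>k. c k) = qpoch_inf (- x) p * qpoch_inf (- y) p * I"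
    using I by (simp add: field_simps)
  then show ?thesis
    using summable_sums[OF summable_norm_cancel[OF c_summable]] by (simp add: c_def I_def)
qed

section \<open>The double series and its evaluation\<close>

theorem theorem2p5:
  fixes q :: complex
  assumes "norm q < 1"
  shows "(\<lambda>n. (-1) ^ n * q ^ (n\<^sup>2 + 2 * n) * qpoch q (q ^ 2) n
              / (qpoch (- q) (q ^ 2) n * qpoch (q ^ 4) (q ^ 4) n))
         sums
         (qpoch_inf (- q) (q ^ 5) * qpoch_inf (- (q ^ 4)) (q ^ 5) * qpoch_inf (q ^ 5) (q ^ 5)
            * qpoch_inf q (q ^ 2)
          / qpoch_inf (q ^ 2) (q ^ 2))"
proof (cases "q = 0")
  case True
  \<comment> \<open>The Bailey pair and the triple product assume a nonzero base. For
    \<open>q = 0\<close> only the term \<open>n = 0\<close> survives, and all the infinite products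
    are 1.\<close>
  have "(\<lambda>n::nat. if n = 0 then 1 else 0 :: complex) sums 1"
    using sums_single[of 0 "\<lambda>_. 1 :: complex"] by simp
  moreover have "(-1) ^ n * q ^ (n\<^sup>2 + 2 * n) * qpoch q (q ^ 2) n
              / (qpoch (- q) (q ^ 2) n * qpoch (q ^ 4) (q ^ 4) n) = (if n = 0 then 1 else 0)" for n
    using True by simp
  ultimately show ?thesis
    using True by (simp add: qpoch_inf_def)
next
  case False
  note q = assms False
  have q_power: "norm (q ^ k) < 1" if "k > 0" for k
    using q that by (simp add: norm_power power_less_one_iff)
  have q2: "norm (q\<^sup>2) < 1"
    by (simp add: q_power)
  define c where "c = (\<lambda>r::nat. (-1) ^ r * q ^ (3 * (r choose 2) + r) * (1 - q ^ (4 * r + 2)))"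
  define d where "d = (\<lambda>n. (-1) ^ n * q ^ (n\<^sup>2 + 2 * n) * qpoch q (q\<^sup>2) n)"
  \<comment> \<open>The double series with \<open>n = r + m\<close>, so that n - r = m and n + r + 1
    = 2r + 1 + m.\<close>
  define f where "f = (\<lambda>r m. c r * d (r + m) / (qpoch (q\<^sup>2) (q\<^sup>2) m * qpoch (q\<^sup>2) (q\<^sup>2) (2 * r + 1 + m)))"
  define L where "L = qpoch_inf q (q\<^sup>2) / qpoch_inf (q\<^sup>2) (q\<^sup>2)"
  define e where "e = (\<lambda>k. (q ^ 5) ^ (k choose 2) * ((q ^ 4) ^ k + q ^ Suc k * (q ^ 5) ^ k))"
  obtain A where A: "A > 0" "\<And>n. norm (qpoch q (q\<^sup>2) n) \<le> A"
    using qpoch_bounded[OF q2] by blast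
  obtain B where B: "B > 0" "\<And>n. norm (inverse (qpoch (q\<^sup>2) (q\<^sup>2) n)) \<le> B"
    using inverse_qpoch_bounded[OF q2 q2] by blast
  have bound: "norm (f r m) \<le> (2 * A * B * B) * norm q ^ r * norm q ^ m" for r m
  proof -
    have "norm (1 - q ^ (4 * r + 2)) \<le> 1 + 1"
      using q_power[of "4 * r + 2"] norm_triangle_ineq4[of 1 "q ^ (4 * r + 2)"] by simp
    moreover have "norm q ^ (3 * (r choose 2) + r) \<le> norm q ^ r"
      using q by (intro power_decreasing) auto
    ultimately have c: "norm (c r) \<le> norm q ^ r * 2"
      unfolding c_def norm_mult by (intro mult_mono) (auto simp: norm_power)
    have "m \<le> (r + m)\<^sup>2 + 2 * (r + m)"
      by simp
    then have "norm q ^ ((r + m)\<^sup>2 + 2 * (r + m)) \<le> norm q ^ m"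
      using q by (intro power_decreasing) auto
    then have d: "norm (d (r + m)) \<le> norm q ^ m * A"
      unfolding d_def norm_mult using A by (intro mult_mono) (auto simp: norm_power)
    have "norm (f r m) = norm (c r) * norm (d (r + m)) *
        (norm (inverse (qpoch (q\<^sup>2) (q\<^sup>2) m)) * norm (inverse (qpoch (q\<^sup>2) (q\<^sup>2) (2 * r + 1 + m))))"
      by (simp add: f_def divide_inverse norm_mult norm_inverse)
    also have "\<dots> \<le> (norm q ^ r * 2) * (norm q ^ m * A) * (B * B)"
      using c d A B by (intro mult_mono) auto
    finally show ?thesis
      by (simp add: mult_ac)
  qed
  have rows: "f r sums (L * e r)" for r
  proof -
    \<comment> \<open>Row \<open>r\<close> is a 1phi1 series in base q^2: \<open>a\<close> continues
      (q;q^2)_r, \<open>z\<close> collects the part of (r+m)^2 + 2(r+m) linear in \<open>m\<close>,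
      and \<open>a * z\<close> = q^(4r+4) continues (q^2;q^2)_{2r+1}.\<close>
    define z where "z = q ^ (2 * r + 3)"
    define a where "a = q ^ (2 * r + 1)"
    have az: "a * z = q\<^sup>2 * (q\<^sup>2) ^ (2 * r + 1)"
      by (simp add: a_def z_def power_mult power_add power_mult_distrib power2_eq_square power3_eq_cube mult_ac)
    have zq: "z = q * (q\<^sup>2) ^ (r + 1)"
      by (simp add: z_def power_mult power_add power_mult_distrib power2_eq_square power3_eq_cube mult_ac)
    have aq: "a = q * (q\<^sup>2) ^ r"
      by (simp add: a_def power_mult)
    have norms: "norm z < 1" "norm (a * z) < 1"
      unfolding az by (simp_all add: z_def q_power norm_mult_power_less_1 q2)
    have row_eq: "f r m = c r * d r / qpoch (q\<^sup>2) (q\<^sup>2) (2 * r + 1) *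
        (qpoch a (q\<^sup>2) m * (- z) ^ m * (q\<^sup>2) ^ (m choose 2) / (qpoch (q\<^sup>2) (q\<^sup>2) m * qpoch (a * z) (q\<^sup>2) m))"
      for m
    proof -
      have "(r + m)\<^sup>2 + 2 * (r + m) = (r\<^sup>2 + 2 * r) + (2 * r + 3) * m + 2 * (m choose 2)"
        using double_choose_two[of m] by (simp add: power2_eq_square algebra_simps)
      then have "q ^ ((r + m)\<^sup>2 + 2 * (r + m)) = q ^ (r\<^sup>2 + 2 * r) * z ^ m * (q\<^sup>2) ^ (m choose 2)"
        by (simp only: z_def power_add power_mult)
      then have "d (r + m) = d r * (qpoch a (q\<^sup>2) m * (- z) ^ m * (q\<^sup>2) ^ (m choose 2))"
        using q(2) by (simp add: d_def qpoch_add aq power_add power_minus[of z] mult_ac)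
      moreover have "qpoch (q\<^sup>2) (q\<^sup>2) (2 * r + 1 + m)
          = qpoch (q\<^sup>2) (q\<^sup>2) (2 * r + 1) * qpoch (a * z) (q\<^sup>2) m"
        unfolding az by (rule qpoch_add)
      ultimately show ?thesis
        unfolding f_def by (simp only: times_divide_times_eq mult_ac)
    qed
    have row_sum: "(\<lambda>m. qpoch a (q\<^sup>2) m * (- z) ^ m * (q\<^sup>2) ^ (m choose 2)
          / (qpoch (q\<^sup>2) (q\<^sup>2) m * qpoch (a * z) (q\<^sup>2) m)) sums (qpoch_inf z (q\<^sup>2) / qpoch_inf (a * z) (q\<^sup>2))"
      by (rule sums_1phi1[OF q2 norms])
    have "f r sums (c r * d r / qpoch (q\<^sup>2) (q\<^sup>2) (2 * r + 1) *
        (qpoch_inf z (q\<^sup>2) / qpoch_inf (a * z) (q\<^sup>2)))"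
      by (rule iffD2[OF sums_cong sums_mult[OF row_sum]]) (rule row_eq)
    moreover have "c r * d r / qpoch (q\<^sup>2) (q\<^sup>2) (2 * r + 1) *
        (qpoch_inf z (q\<^sup>2) / qpoch_inf (a * z) (q\<^sup>2)) = L * e r"
    proof -
      define M where "M = q ^ (5 * (r choose 2) + 4 * r)"
      \<comment> \<open>The tail starting at \<open>z\<close> leaves out r + 1 factors of
        (q;q^2)_\<infinity>, one more than \<open>d r\<close> contains. The missing
        \<open>1 - a\<close> comes from 1 - q^(4r+2) = (1 - a)(1 + a) in \<open>c r\<close>.\<close>
      have "qpoch_inf q (q\<^sup>2) = qpoch q (q\<^sup>2) r * (1 - a) * qpoch_inf z (q\<^sup>2)"
        using qpoch_inf_split[OF q2, of q "r + 1"] by (simp add: zq aq qpoch_Suc)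
      moreover have "qpoch_inf (q\<^sup>2) (q\<^sup>2) = qpoch (q\<^sup>2) (q\<^sup>2) (2 * r + 1) * qpoch_inf (a * z) (q\<^sup>2)"
        using qpoch_inf_split[OF q2, of "q\<^sup>2" "2 * r + 1"] by (simp only: az)
      ultimately have L: "L = qpoch q (q\<^sup>2) r * (1 - a) * qpoch_inf z (q\<^sup>2)
          / (qpoch (q\<^sup>2) (q\<^sup>2) (2 * r + 1) * qpoch_inf (a * z) (q\<^sup>2))"
        by (simp only: L_def)
      \<comment> \<open>The two quadratic exponents add up to one with coefficient 5, which produces
        the base q^5; the signs cancel.\<close>
      have "5 * (r choose 2) + 4 * r = 3 * (r choose 2) + r + (r\<^sup>2 + 2 * r)"
        using double_choose_two[of r] by (simp add: power2_eq_square)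
      then have M: "M = q ^ (3 * (r choose 2) + r) * q ^ (r\<^sup>2 + 2 * r)"
        by (simp only: M_def power_add)
      have "4 * r + 2 = (2 * r + 1) * 2"
        by simp
      then have "q ^ (4 * r + 2) = a\<^sup>2"
        by (simp only: a_def power_mult)
      then have "c r * d r = ((-1) ^ r * (-1) ^ r) * M * (1 - a\<^sup>2) * qpoch q (q\<^sup>2) r"
        by (simp add: c_def d_def M mult_ac)
      also have "\<dots> = M * (1 - a) * (1 + a) * qpoch q (q\<^sup>2) r"
        by (simp add: power2_eq_square algebra_simps flip: power_add)
      finally have cd: "c r * d r = M * (1 - a) * (1 + a) * qpoch q (q\<^sup>2) r" .
      \<comment> \<open>The remaining factor \<open>1 + a\<close> splits row \<open>r\<close> into
        the two terms of one paired summand of the triple product.\<close>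
      have "Suc r + 5 * r = 4 * r + (2 * r + 1)"
        by simp
      then have "q ^ Suc r * (q ^ 5) ^ r = (q ^ 4) ^ r * a"
        by (simp only: a_def flip: power_mult power_add)
      moreover have "M = (q ^ 5) ^ (r choose 2) * (q ^ 4) ^ r"
        by (simp only: M_def power_add power_mult)
      ultimately have e: "e r = M * (1 + a)"
        unfolding e_def by (simp only: ring_distribs mult_ac mult_1_left mult_1_right)
      show ?thesis
        unfolding cd e L by (simp add: mult_ac)
    qed
    ultimately show ?thesis
      by simp
  qed
  \<comment> \<open>The triple product with \<open>p = q ^ 5\<close>, \<open>x = q ^ 4\<close> and
    \<open>y = q\<close>.\<close>
  have "e sums (qpoch_inf (- (q ^ 4)) (q ^ 5) * qpoch_inf (- q) (q ^ 5) * qpoch_inf (q ^ 5) (q ^ 5))"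
    unfolding e_def using q by (intro jacobi_triple_product) (simp_all add: q_power flip: power_Suc2)
  then have "(\<lambda>r. L * e r) sums
      (L * (qpoch_inf (- (q ^ 4)) (q ^ 5) * qpoch_inf (- q) (q ^ 5) * qpoch_inf (q ^ 5) (q ^ 5)))"
    by (rule sums_mult)
  with bound rows have "(\<lambda>n. \<Sum>r\<le>n. f r (n - r)) sums
      (L * (qpoch_inf (- (q ^ 4)) (q ^ 5) * qpoch_inf (- q) (q ^ 5) * qpoch_inf (q ^ 5) (q ^ 5)))"
    using q by (intro triangle_sums) auto
  moreover have "(\<Sum>r\<le>n. f r (n - r)) = (-1) ^ n * q ^ (n\<^sup>2 + 2 * n) * qpoch q (q\<^sup>2) n
              / (qpoch (- q) (q\<^sup>2) n * qpoch (q ^ 4) (q ^ 4) n)" for n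
  proof -
    \<comment> \<open>On the diagonal \<open>n\<close> the factor \<open>d n\<close> is constant,
      and the rest is the Bailey pair sum.\<close>
    have "(\<Sum>r\<le>n. f r (n - r)) = d n * (\<Sum>r\<le>n. c r
            / (qpoch (q\<^sup>2) (q\<^sup>2) (n - r) * qpoch (q\<^sup>2) (q\<^sup>2) (n + r + 1)))"
      unfolding sum_distrib_left by (intro sum.cong) (auto simp: f_def mult_2 add_ac mult_ac)
    also have "\<dots> = d n * (1 / (qpoch (- q) (q\<^sup>2) n * qpoch (q ^ 4) (q ^ 4) n))"
      unfolding c_def bailey_pair[OF q] ..
    finally show ?thesis
      by (simp add: d_def)
  qed
  ultimately show ?thesis
    by (simp add: L_def mult_ac)
qed

end
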